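(* Let $T>0$, and let $(x^{(i)},y^{(i)})\in\mathbb R^d\times\mathbb R^d$ for $i\in\{1,\dots,n\}$ be such that $x^{(i)}\neq x^{(j)}$ and $y^{(i)}\neq y^{(j)}$ whenever $i\neq j$. Then there exists $\theta=(w,b):[0,T]\to\mathbb R^{d\times d}\times\mathbb R^d$, piecewise constant with at most $4n+2$ switches, such that the flow map $\Phi^t_\theta:\mathbb R^d\to\mathbb R^d$ $(t\in[0,T])$ of $$\dot x(t)=w(t)\,(x(t))_++b(t)$$ satisfies $$\Phi^T_\theta\big(x^{(i)}\big)=y^{(i)}\qquad\text{for all }i\in\{1,\dots,n\}.$$
   Context: Here $d$ and $n$ are positive integers. For $x\in\mathbb R^d$, $(x)_+\in\mathbb R^d$ is defined component-wise by $((x)_+)_k=\max\{x_k,0\}$. The flow map is $\Phi^t_\theta(x_0)=x(t)$, where $x(\cdot)$ is the unique solution of the differential equation with $x(0)=x_0$. A switch of a piecewise constant function is a point of discontinuity.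
   Formalization: The dimension is assumed to satisfy d ≥ 2; for d = 1 the flow map is strictly increasing, so the claim fails, e.g. for n = 2, x = (0,1), y = (1,0). *)

theory Defs
  imports "HOL-Analysis.Analysis"
begin

definition pos_part :: "real ^ 'd \<Rightarrow> real ^ 'd" where
  "pos_part x = (\<chi> k. max (x $ k) 0)"

text \<open>The values at the breakpoints are unconstrained here; a value that differs from the
  one-sided limits is a discontinuity and is therefore counted by \<open>switches\<close> below.\<close>

definition piecewise_constant_on :: "real \<Rightarrow> real \<Rightarrow> (real \<Rightarrow> 'a) \<Rightarrow> bool" where
  "piecewise_constant_on a b f \<longleftrightarrow>
     (\<exists>(m::nat) (\<tau>::nat \<Rightarrow> real). \<tau> 0 = a \<and> \<tau> m = b \<and>
        (\<forall>k<m. \<tau> k < \<tau> (Suc k) \<and> f constant_on {\<tau> k<..<\<tau> (Suc k)}))"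

definition switches :: "real \<Rightarrow> real \<Rightarrow> (real \<Rightarrow> 'a::topological_space) \<Rightarrow> real set" where
  "switches a b f = {t \<in> {a..b}. \<not> continuous (at t within {a..b}) f}"

text \<open>For piecewise constant controls the right-hand side jumps at the switches, so a solution is a
  continuous curve that satisfies the differential equation at every other time; there are only
  finitely many switches, so this is the same as a Caratheodory solution. At the endpoints
  the derivative is one-sided.\<close>

definition is_solution ::
  "real \<Rightarrow> (real \<Rightarrow> (real ^ 'd ^ 'd) \<times> (real ^ 'd)) \<Rightarrow> real ^ 'd \<Rightarrow> (real \<Rightarrow> real ^ 'd) \<Rightarrow> bool"
  where
  "is_solution T \<theta> x0 x \<longleftrightarrow>
     x 0 = x0 \<and> continuous_on {0..T} x \<and>
     (\<forall>t \<in> {0..T} - switches 0 T \<theta>.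
        (x has_vector_derivative (fst (\<theta> t) *v pos_part (x t) + snd (\<theta> t))) (at t within {0..T}))"

text \<open>\<open>\<Phi>\<close> is the flow map: from every initial point there is a solution on \<open>[0,T]\<close>, it is unique
  there, and \<open>\<Phi> t x0\<close> is its value at time \<open>t\<close>. Values for \<open>t\<close> outside \<open>[0,T]\<close> are irrelevant.\<close>

definition is_flow_map ::
  "real \<Rightarrow> (real \<Rightarrow> (real ^ 'd ^ 'd) \<times> (real ^ 'd)) \<Rightarrow> (real \<Rightarrow> real ^ 'd \<Rightarrow> real ^ 'd) \<Rightarrow> bool"
  where
  "is_flow_map T \<theta> \<Phi> \<longleftrightarrow>
     (\<forall>x0. is_solution T \<theta> x0 (\<lambda>t. \<Phi> t x0) \<and>
        (\<forall>x. is_solution T \<theta> x0 x \<longrightarrow> (\<forall>t\<in>{0..T}. x t = \<Phi> t x0)))"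

end

theory Submission imports Defs begin

text \<open>A shear with positive coefficients, applied after a translation into the positive orthant, makes
  the points distinct in one chosen coordinate \<open>k\<close>. While \<open>x\<^sub>k\<close> decreases at constant
  speed, the other coordinates can be driven by \<open>(x\<^sub>k)\<^sub>+\<close>, which leaves all points with
  \<open>x\<^sub>k \<le> 0\<close> undeformed. So the points can be treated one after the other, in increasing order of
  \<open>x\<^sub>k\<close>, and \<open>n\<close> pieces prescribe all coordinates except the \<open>k\<close>-th one. Two such
  passes, with different coordinates \<open>k\<close> and \<open>l\<close>, and a translation prescribe everything,
  provided that the targets are distinct in the \<open>l\<close>-th coordinate; this holds after the inverse
  of a translation and a shear. In total there are \<open>2 + n + n + 1 + 2\<close> pieces, that is, at most
  \<open>2 n + 4 \<le> 4 n + 2\<close> switches.\<close>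

subsection \<open>Two-layer vector fields\<close>

definition drift :: "(real ^ 'd ^ 'd) \<times> (real ^ 'd) \<Rightarrow> real ^ 'd \<Rightarrow> real ^ 'd" where
  "drift p x = fst p *v pos_part x + snd p"

text \<open>In the directed graph of nonzero entries of \<open>w\<close> no two edges are
  consecutive; in particular there are no loops.\<close>

definition two_layer :: "(real ^ 'd ^ 'd) \<times> (real ^ 'd) \<Rightarrow> bool" where
  "two_layer p \<longleftrightarrow> (\<forall>k j l. fst p $ k $ j \<noteq> 0 \<longrightarrow> fst p $ j $ l = 0)"

text \<open>Coordinates with a zero row in \<open>w\<close> move with constant velocity, and all other coordinates are
  driven by these alone. Hence the equation is solved by one integration, which gives the formula for
  \<open>layer_flow\<close> and also uniqueness.\<close>

definition layer_flow :: "(real ^ 'd ^ 'd) \<times> (real ^ 'd) \<Rightarrow> real \<Rightarrow> real ^ 'd \<Rightarrow> real ^ 'd" where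
  "layer_flow p t x =
     x + t *\<^sub>R snd p + fst p *v integral {0..t} (\<lambda>s. pos_part (x + s *\<^sub>R snd p))"

lemma continuous_on_pos_part_line: "continuous_on S (\<lambda>s. pos_part (x + s *\<^sub>R b))"
  unfolding pos_part_def by (intro continuous_intros)

lemma layer_flow_0 [simp]: "layer_flow p 0 x = x"
  by (simp add: layer_flow_def)

lemma matrix_vector_mult_cong_row:
  fixes A :: "real ^ 'm ^ 'n"
  assumes "\<And>k j. A $ k $ j \<noteq> 0 \<Longrightarrow> u $ j = v $ j"
  shows "A *v u = A *v v"
proof -
  have "A $ k $ j * u $ j = A $ k $ j * v $ j" for k j
    using assms[of k j] by (cases "A $ k $ j = 0") auto
  then show ?thesis by (simp only: matrix_vector_mult_def)
qed

lemma two_layer_row_eq_0: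
  assumes "two_layer p" "fst p $ k $ j \<noteq> 0"
  shows "(fst p *v u) $ j = 0"
  using assms by (simp add: two_layer_def matrix_vector_mult_def)

lemma layer_flow_has_vector_derivative:
  assumes "two_layer p" "0 \<le> t" "t \<le> h"
  shows "((\<lambda>t. layer_flow p t x) has_vector_derivative drift p (layer_flow p t x)) (at t within {0..h})"
proof -
  have "((\<lambda>t. integral {0..t} (\<lambda>s. pos_part (x + s *\<^sub>R snd p))) has_vector_derivative
      pos_part (x + t *\<^sub>R snd p)) (at t within {0..h})"
    by (rule integral_has_vector_derivative) (use assms continuous_on_pos_part_line in auto)
  from bounded_linear.has_vector_derivative[OF matrix_vector_mul_bounded_linear this, of "fst p"]
  have "((\<lambda>t. layer_flow p t x) has_vector_derivative
      0 + 1 *\<^sub>R snd p + fst p *v pos_part (x + t *\<^sub>R snd p)) (at t within {0..h})"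
    unfolding layer_flow_def by (auto intro!: derivative_eq_intros)
  \<comment> \<open>A coordinate that \<open>fst p\<close> reads has a zero row, so the integral
    term leaves it on the straight line; all other coordinates meet zero entries.\<close>
  moreover have "fst p *v pos_part (x + t *\<^sub>R snd p) = fst p *v pos_part (layer_flow p t x)"
    by (rule matrix_vector_mult_cong_row)
      (simp add: pos_part_def layer_flow_def two_layer_row_eq_0[OF assms(1)])
  ultimately show ?thesis by (simp add: drift_def add.commute)
qed

lemma drift_solution_unique:
  fixes x y :: "real \<Rightarrow> real ^ 'd"
  assumes p: "two_layer p" and "a < b"
    and cx: "continuous_on {a..b} x" and cy: "continuous_on {a..b} y"
    and dx: "\<And>t. t \<in> {a<..<b} \<Longrightarrow> (x has_vector_derivative drift p (x t)) (at t)"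
    and dy: "\<And>t. t \<in> {a<..<b} \<Longrightarrow> (y has_vector_derivative drift p (y t)) (at t)"
    and init: "x a = y a" and t: "t \<in> {a..b}"
  shows "x t = y t"
proof -
  define D where "D t j = x t $ j - y t $ j" for t j
  have der: "((\<lambda>t. D t j) has_real_derivative (drift p (x t) $ j - drift p (y t) $ j)) (at t)"
    if "t \<in> {a<..<b}" for t j
    unfolding D_def has_real_derivative_iff_has_vector_derivative
    using bounded_linear.has_vector_derivative[OF bounded_linear_vec_nth dx[OF that]]
      bounded_linear.has_vector_derivative[OF bounded_linear_vec_nth dy[OF that]]
    by (intro has_vector_derivative_diff)
  \<comment> \<open>Applied twice: first to the coordinates that \<open>fst p\<close> reads, whose
    drift is constant, and then, since these agree, to every coordinate.\<close>
  have eq: "x t $ j = y t $ j"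
    if "\<And>s. s \<in> {a<..<b} \<Longrightarrow> drift p (x s) $ j = drift p (y s) $ j" and "t \<in> {a..b}" for j t
  proof -
    have "D t j = D a j"
    proof (rule DERIV_isconst2[OF \<open>a < b\<close>])
      show "continuous_on {a..b} (\<lambda>t. D t j)"
        unfolding D_def by (intro continuous_intros cx cy)
    qed (use der[of _ j] that in auto)
    then show ?thesis using init by (simp add: D_def)
  qed
  have input: "x s $ j = y s $ j" if "fst p $ k $ j \<noteq> 0" "s \<in> {a..b}" for k j s
    by (rule eq) (simp_all add: drift_def two_layer_row_eq_0[OF p that(1)] that(2)[simplified])
  have "drift p (x s) = drift p (y s)" if "s \<in> {a<..<b}" for s
    unfolding drift_def
    by (rule arg_cong[where f = "\<lambda>u. u + snd p"], rule matrix_vector_mult_cong_row)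
      (use input that in \<open>force simp: pos_part_def\<close>)
  then have "x t $ j = y t $ j" for j by (intro eq t) simp
  then show ?thesis by (simp add: vec_eq_iff)
qed

subsection \<open>Concatenation of two-layer flows\<close>

text \<open>Glues the one-sided derivatives of the two pieces that meet at a node.\<close>

lemma has_vector_derivative_finite_Union:
  assumes "finite I" "\<And>i. i \<in> I \<Longrightarrow> (f has_vector_derivative f') (at t within S i)"
  shows "(f has_vector_derivative f') (at t within (\<Union>i\<in>I. S i))"
  using assms
proof (induction I)
  case empty
  then show ?case
    by (simp add: has_vector_derivative_def has_derivative_def bounded_linear_scaleR_left)
next
  case (insert i I)
  then show ?case
    by (simp add: has_vector_derivative_def has_derivative_within Lim_within_Un bounded_linear_scaleR_left)
qed

locale control_sequence =
  fixes ps :: "((real ^ 'd ^ 'd) \<times> (real ^ 'd)) list" and h :: real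
  assumes nonempty: "ps \<noteq> []" and h_pos: "h > 0"
    and two_layer: "\<And>p. p \<in> set ps \<Longrightarrow> two_layer p"
begin

text \<open>Pieces are closed on the left and open on the right; the \<open>min\<close> assigns the
  final time to the last piece.\<close>

definition piece :: "real \<Rightarrow> nat" where
  "piece t = min (length ps - 1) (nat \<lfloor>t / h\<rfloor>)"

definition control :: "real \<Rightarrow> (real ^ 'd ^ 'd) \<times> (real ^ 'd)" where
  "control t = ps ! piece t"

definition node :: "nat \<Rightarrow> real ^ 'd \<Rightarrow> real ^ 'd" where
  "node k x = fold (\<lambda>p. layer_flow p h) (take k ps) x"

definition flow :: "real \<Rightarrow> real ^ 'd \<Rightarrow> real ^ 'd" where
  "flow t x = layer_flow (ps ! piece t) (t - real (piece t) * h) (node (piece t) x)"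

lemma node_Suc: "k < length ps \<Longrightarrow> node (Suc k) x = layer_flow (ps ! k) h (node k x)"
  by (simp add: node_def take_Suc_conv_app_nth)

lemma piece_eq:
  assumes "k < length ps" "real k * h \<le> t" "t < real (Suc k) * h"
  shows "piece t = k"
proof -
  have "\<lfloor>t / h\<rfloor> = int k"
    using assms h_pos by (intro floor_unique) (simp_all add: field_simps)
  then show ?thesis using assms(1) by (simp add: piece_def)
qed

lemma piece_end: "piece (real (length ps) * h) = length ps - 1"
  using h_pos by (simp add: piece_def)

lemma control_eq:
  assumes "k < length ps" "real k * h \<le> t" "t < real (Suc k) * h"
  shows "control t = ps ! k"
  using piece_eq[OF assms] by (simp add: control_def)

text \<open>The right end is included because the formulas of neighbouring pieces agree at their
  common node by \<open>node_Suc\<close>; at the final time the \<open>min\<close> in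
  \<open>piece\<close> selects the last piece.\<close>

lemma flow_eq:
  assumes k: "k < length ps" and t: "real k * h \<le> t" "t \<le> real (Suc k) * h"
  shows "flow t x = layer_flow (ps ! k) (t - real k * h) (node k x)"
proof -
  consider "t < real (Suc k) * h" | "t = real (Suc k) * h" "Suc k < length ps"
    | "t = real (Suc k) * h" "Suc k = length ps"
    using t k by linarith
  then show ?thesis
  proof cases
    case 1
    then show ?thesis using piece_eq[OF k t(1)] by (simp add: flow_def)
  next
    case 2
    then have "piece t = Suc k" using h_pos by (intro piece_eq) auto
    then show ?thesis using 2 k by (simp add: flow_def node_Suc algebra_simps)
  next
    case 3
    then have "piece t = k" using piece_end by (metis diff_Suc_1)
    then show ?thesis by (simp add: flow_def)
  qed
qed

lemma flow_end: "flow (real (length ps) * h) x = fold (\<lambda>p. layer_flow p h) ps x"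
proof -
  obtain k where k: "length ps = Suc k" using nonempty by (cases ps) auto
  then have "flow (real (length ps) * h) x = node (Suc k) x"
    using flow_eq[of k "real (length ps) * h" x] h_pos by (simp add: node_Suc algebra_simps)
  then show ?thesis by (simp add: node_def k)
qed

lemma interval_cover:
  "{0..real (length ps) * h} = (\<Union>k<length ps. {real k * h..real (Suc k) * h})"
proof (intro set_eqI iffI)
  fix t assume t: "t \<in> {0..real (length ps) * h}"
  show "t \<in> (\<Union>k<length ps. {real k * h..real (Suc k) * h})"
  proof (cases "t = real (length ps) * h")
    case True
    then show ?thesis using nonempty h_pos
      by (intro UN_I[of "length ps - 1"]) (auto simp: Suc_pred')
  next
    case False
    define k where "k = nat \<lfloor>t / h\<rfloor>"
    have "t / h \<ge> 0" using t h_pos by simp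
    then have "real k \<le> t / h" "t / h < real k + 1" by (simp_all add: k_def)
    then have k: "real k * h \<le> t" "t < real (Suc k) * h" using h_pos by (simp_all add: field_simps)
    have "real k * h < real (length ps) * h" using k t False by simp
    then have "k < length ps" using h_pos by simp
    then show ?thesis using k by (intro UN_I[of k]) auto
  qed
next
  fix t assume "t \<in> (\<Union>k<length ps. {real k * h..real (Suc k) * h})"
  then obtain k where k: "k < length ps" "real k * h \<le> t" "t \<le> real (Suc k) * h" by auto
  have "real (Suc k) * h \<le> real (length ps) * h"
    using k(1) h_pos by (intro mult_right_mono) auto
  moreover have "0 \<le> real k * h" using h_pos by simp
  ultimately show "t \<in> {0..real (length ps) * h}" using k by auto
qed

lemma piece_interval_subset:
  "k < length ps \<Longrightarrow> {real k * h..real (Suc k) * h} \<subseteq> {0..real (length ps) * h}"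
  unfolding interval_cover by blast

section \<open>Switches of the concatenated control\<close>

lemma piecewise_constant_control: "piecewise_constant_on 0 (real (length ps) * h) control"
  unfolding piecewise_constant_on_def
proof (intro exI[of _ "length ps"] exI[of _ "\<lambda>k. real k * h"] conjI allI impI)
  fix k assume "k < length ps"
  then show "control constant_on {real k * h<..<real (Suc k) * h}"
    unfolding constant_on_def by (intro exI[of _ "ps ! k"]) (auto intro!: control_eq)
qed (use h_pos in auto)

lemma control_locally_constant:
  assumes "k < length ps" "real k * h < t" "t < real (Suc k) * h"
  shows "continuous (at t) control"
proof -
  have "eventually (\<lambda>s. s \<in> {real k * h<..<real (Suc k) * h}) (nhds t)"
    using assms by (intro eventually_nhds_in_open) auto
  then have "eventually (\<lambda>s. control s = ps ! k) (nhds t)"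
    by eventually_elim (use assms(1) control_eq in force)
  then have "isCont control t \<longleftrightarrow> isCont (\<lambda>_. ps ! k) t" by (rule isCont_cong)
  then show ?thesis by simp
qed

text \<open>The end times are excluded because continuity is tested within the time interval, and
  \<open>control\<close> is constant on a relative neighbourhood of each.\<close>

lemma switches_subset:
  "switches 0 (real (length ps) * h) control \<subseteq> (\<lambda>k. real k * h) ` {1..<length ps}"
proof
  fix t assume "t \<in> switches 0 (real (length ps) * h) control"
  then have t: "t \<in> {0..real (length ps) * h}"
    and disc: "\<not> continuous (at t within {0..real (length ps) * h}) control"
    by (auto simp: switches_def)
  from t obtain k where k: "k < length ps" "real k * h \<le> t" "t \<le> real (Suc k) * h"
    unfolding interval_cover by auto
  have eq_imp: "continuous (at t within {0..real (length ps) * h}) control"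
    if "open U" "t \<in> U" "\<And>s. s \<in> U \<Longrightarrow> s \<in> {0..real (length ps) * h} \<Longrightarrow> control s = c" for U c
  proof -
    have "eventually (\<lambda>s. control s = c) (at t within {0..real (length ps) * h})"
      unfolding eventually_at_topological using that by blast
    moreover have "control t = c" using that t by blast
    ultimately show ?thesis
      by (simp add: continuous_within tendsto_eventually)
  qed
  have not_interior: "t = real k * h \<or> t = real (Suc k) * h"
    using k control_locally_constant[of k t] disc continuous_at_imp_continuous_at_within
    by fastforce
  have "t \<noteq> 0"
  proof
    assume "t = 0"
    show False
      by (rule notE[OF disc], rule eq_imp[of "{..<h}" "ps ! 0"])
        (use \<open>t = 0\<close> nonempty h_pos in \<open>auto intro!: control_eq\<close>)
  qed
  moreover have "t \<noteq> real (length ps) * h"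
  proof
    assume tT: "t = real (length ps) * h"
    obtain m where m: "length ps = Suc m" using nonempty by (cases ps) auto
    show False
    proof (rule notE[OF disc], rule eq_imp[of "{real m * h<..}" "ps ! m"])
      fix s assume s: "s \<in> {real m * h<..}" "s \<in> {0..real (length ps) * h}"
      show "control s = ps ! m"
      proof (cases "s = real (length ps) * h")
        case True
        then show ?thesis using piece_end by (simp add: control_def m)
      next
        case False
        then show ?thesis using s by (intro control_eq) (auto simp: m)
      qed
    qed (use tT m h_pos in auto)
  qed
  ultimately show "t \<in> (\<lambda>k. real k * h) ` {1..<length ps}"
    using not_interior k(1)
  proof (elim disjE)
    assume "t = real k * h" "t \<noteq> 0"
    then show ?thesis using k(1) by (intro image_eqI[of _ _ k]) (auto simp: Suc_le_eq intro: Nat.gr0I)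
  next
    assume "t = real (Suc k) * h" "t \<noteq> real (length ps) * h"
    moreover then have "Suc k \<noteq> length ps" by auto
    ultimately show ?thesis using k(1) by (intro image_eqI[of _ _ "Suc k"]) auto
  qed
qed

lemma finite_switches: "finite (switches 0 (real (length ps) * h) control)"
  using switches_subset finite_subset by blast

lemma card_switches: "card (switches 0 (real (length ps) * h) control) \<le> length ps - 1"
  using surj_card_le[OF _ switches_subset] by simp

text \<open>A node need not be a switch, since consecutive entries of \<open>ps\<close> may
  coincide. There the value of \<open>control\<close> equals its limit from inside either adjacent
  piece, so both pieces give the same differential equation.\<close>

lemma control_eq_at_continuity:
  assumes k: "k < length ps" and t: "t \<in> {real k * h..real (Suc k) * h}"
    and cont: "t \<notin> switches 0 (real (length ps) * h) control"
  shows "control t = ps ! k"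
proof -
  let ?J = "{real k * h<..<real (Suc k) * h}"
  have J: "?J \<subseteq> {0..real (length ps) * h}"
    using piece_interval_subset[OF k] by fastforce
  have "t \<in> {0..real (length ps) * h}" using piece_interval_subset[OF k] t by blast
  then have "continuous (at t within {0..real (length ps) * h}) control"
    using cont by (simp add: switches_def)
  then have "(control \<longlongrightarrow> control t) (at t within ?J)"
    using continuous_within tendsto_within_subset J by blast
  moreover have "eventually (\<lambda>s. control s = ps ! k) (at t within ?J)"
    unfolding eventually_at_topological using k control_eq by force
  then have "(control \<longlongrightarrow> ps ! k) (at t within ?J)"
    by (rule tendsto_eventually)
  moreover have "at t within ?J \<noteq> bot"
  proof -
    have "real k * h < real (Suc k) * h" using h_pos by simp
    then have "t islimpt ?J" using t islimpt_Icc limpt_of_closure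
      by (metis closure_greaterThanLessThan)
    then show ?thesis by (simp add: trivial_limit_within)
  qed
  ultimately show ?thesis using tendsto_unique by blast
qed

section \<open>Existence and uniqueness of solutions\<close>

lemma flow_piece_has_vector_derivative:
  assumes k: "k < length ps" and t: "t \<in> {real k * h..real (Suc k) * h}"
  shows "((\<lambda>t. flow t x) has_vector_derivative drift (ps ! k) (flow t x))
     (at t within {real k * h..real (Suc k) * h})"
proof -
  let ?g = "\<lambda>s. layer_flow (ps ! k) s (node k x)"
  let ?I = "{real k * h..real (Suc k) * h}"
  have eq: "flow s x = ?g (s - real k * h)" if "s \<in> ?I" for s
    using flow_eq[OF k] that by simp
  have im: "(\<lambda>t. t - real k * h) ` ?I \<subseteq> {0..h}" using h_pos by (auto simp: algebra_simps)
  have "(?g has_vector_derivative drift (ps ! k) (?g (t - real k * h)))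
      (at (t - real k * h) within {0..h})"
    using t by (intro layer_flow_has_vector_derivative two_layer) (auto simp: k algebra_simps)
  then have "(?g has_vector_derivative drift (ps ! k) (?g (t - real k * h)))
      (at (t - real k * h) within (\<lambda>t. t - real k * h) ` ?I)"
    using im has_vector_derivative_within_subset by blast
  moreover have "((\<lambda>t. t - real k * h) has_vector_derivative 1) (at t within ?I)"
    by (auto intro!: derivative_eq_intros)
  ultimately have "((\<lambda>t. ?g (t - real k * h)) has_vector_derivative
      drift (ps ! k) (?g (t - real k * h))) (at t within ?I)"
    using vector_diff_chain_within[of "\<lambda>t. t - real k * h" 1 t ?I ?g] by (simp add: o_def)
  then show ?thesis
    unfolding eq[OF t] by - (rule has_vector_derivative_transform[OF t eq])
qed

lemma flow_is_solution: "is_solution (real (length ps) * h) control x (\<lambda>t. flow t x)"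
  unfolding is_solution_def
proof (intro conjI ballI)
  show "flow 0 x = x"
    using flow_eq[of 0 0 x] nonempty h_pos by (simp add: node_def)
  show "continuous_on {0..real (length ps) * h} (\<lambda>t. flow t x)"
    unfolding interval_cover
  proof (rule continuous_on_closed_Union)
    fix k assume "k \<in> {..<length ps}"
    then show "continuous_on {real k * h..real (Suc k) * h} (\<lambda>t. flow t x)"
      using flow_piece_has_vector_derivative has_vector_derivative_continuous
      unfolding continuous_on_eq_continuous_within lessThan_iff by blast
  qed auto
  fix t assume t: "t \<in> {0..real (length ps) * h} - switches 0 (real (length ps) * h) control"
  have "((\<lambda>t. flow t x) has_vector_derivative drift (control t) (flow t x))
      (at t within {real k * h..real (Suc k) * h})" if "k < length ps" for k
  proof (cases "t \<in> {real k * h..real (Suc k) * h}")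
    case True
    then show ?thesis
      using flow_piece_has_vector_derivative[OF that True] control_eq_at_continuity[OF that True] t
      by simp
  next
    \<comment> \<open>Away from the closed piece the filter is trivial, so any derivative is
      admissible and the gluing lemma can run over all pieces.\<close>
    case False
    then have "at t within {real k * h..real (Suc k) * h} = bot"
      using not_in_closure_trivial_limitI[of t "{real k * h..real (Suc k) * h}"] by simp
    then show ?thesis by (simp add: has_vector_derivative_def has_derivative_def bounded_linear_scaleR_left)
  qed
  then show "((\<lambda>t. flow t x) has_vector_derivative
      fst (control t) *v pos_part (flow t x) + snd (control t)) (at t within {0..real (length ps) * h})"
    unfolding interval_cover drift_def[symmetric]
    by (intro has_vector_derivative_finite_Union) auto
qed

text \<open>Induction over the nodes: on one piece the control is constant in the interior, so two
  solutions that agree at its left node agree up to its right node.\<close>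

lemma solution_unique:
  assumes sol: "is_solution (real (length ps) * h) control x0 x" and t: "t \<in> {0..real (length ps) * h}"
  shows "x t = flow t x0"
proof -
  let ?T = "real (length ps) * h"
  have on_piece: "z s = flow s x0"
    if k: "k < length ps" and z: "is_solution ?T control x0 z"
      and init: "z (real k * h) = flow (real k * h) x0" and s: "s \<in> {real k * h..real (Suc k) * h}"
    for k z s
  proof (rule drift_solution_unique)
    show "two_layer (ps ! k)" using k two_layer by simp
    show "real k * h < real (Suc k) * h" using h_pos by simp
    have cont: "continuous_on {real k * h..real (Suc k) * h} u" 
      if "is_solution ?T control x0 u" for u
      using that piece_interval_subset[OF k] continuous_on_subset is_solution_def by metis
    show "continuous_on {real k * h..real (Suc k) * h} z" 
      "continuous_on {real k * h..real (Suc k) * h} (\<lambda>t. flow t x0)"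
      using cont z flow_is_solution by auto
    have der: "(u has_vector_derivative drift (ps ! k) (u t)) (at t)"
      if u: "is_solution ?T control x0 u" and t: "t \<in> {real k * h<..<real (Suc k) * h}" for u t
    proof -
      have sub: "{real k * h<..<real (Suc k) * h} \<subseteq> {0..?T}"
        using piece_interval_subset[OF k] by fastforce
      have "continuous (at t within {0..?T}) control"
        using control_locally_constant[OF k, of t] t continuous_at_imp_continuous_at_within by auto
      then have "t \<in> {0..?T} - switches 0 ?T control" using t sub by (auto simp: switches_def)
      then have "(u has_vector_derivative drift (control t) (u t)) (at t within {0..?T})"
        using u unfolding is_solution_def drift_def by blast
      moreover have "at t within {0..?T} = at t"
        using t sub by (intro at_within_interior) (meson interior_maximal open_greaterThanLessThan subsetD)
      ultimately show ?thesis using control_eq[OF k, of t] t by simp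
    qed
    show "(z has_vector_derivative drift (ps ! k) (z t)) (at t)"
      "((\<lambda>t. flow t x0) has_vector_derivative drift (ps ! k) (flow t x0)) (at t)"
      if "t \<in> {real k * h<..<real (Suc k) * h}" for t
      using der[OF z that] der[OF flow_is_solution that] by auto
  qed (use init s in auto)
  have node: "x (real k * h) = flow (real k * h) x0" if "k \<le> length ps" for k
    using that
  proof (induction k)
    case 0
    then show ?case using sol flow_is_solution[of x0] by (simp add: is_solution_def)
  next
    case (Suc k)
    then have "k < length ps" "x (real k * h) = flow (real k * h) x0" by auto
    from on_piece[OF this(1) sol this(2), of "real (Suc k) * h"]
    show ?case using h_pos by simp
  qed
  from t obtain k where "k < length ps" "t \<in> {real k * h..real (Suc k) * h}"
    unfolding interval_cover by auto
  then show ?thesis using on_piece[of k x t] sol node[of k] by simp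
qed

lemma flow_is_flow_map: "is_flow_map (real (length ps) * h) control flow"
  unfolding is_flow_map_def using flow_is_solution solution_unique by blast

end

subsection \<open>Elementary moves\<close>

lemma layer_flow_translation:
  assumes "h \<noteq> 0"
  shows "layer_flow (0, c /\<^sub>R h) h x = x + c"
  using assms by (simp add: layer_flow_def)

lemma two_layer_translation: "two_layer (0, c)"
  by (simp add: two_layer_def)

definition row_matrix :: "'d \<Rightarrow> real ^ 'd \<Rightarrow> real ^ 'd ^ 'd" where
  "row_matrix k v = (\<chi> i. if i = k then v else 0)"

lemma two_layer_shear:
  assumes "v $ k = 0"
  shows "two_layer (row_matrix k v, 0)"
  using assms by (auto simp: two_layer_def row_matrix_def)

lemma row_matrix_mult_vec: "row_matrix k v *v u = axis k (v \<bullet> u)"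
  by (simp add: row_matrix_def matrix_vector_mult_def vec_eq_iff axis_def inner_vec_def)

lemma layer_flow_shear:
  assumes "h > 0"
  shows "layer_flow (row_matrix k (v /\<^sub>R h), 0) h x = x + axis k (v \<bullet> pos_part x)"
  using assms by (simp add: layer_flow_def row_matrix_mult_vec flip: mult.assoc)

definition column_matrix :: "'d \<Rightarrow> real ^ 'd \<Rightarrow> real ^ 'd ^ 'd" where
  "column_matrix k v = (\<chi> i j. if j = k then v $ i else 0)"

text \<open>The positive part of a coordinate that starts at \<open>a\<close> and falls with speed
  \<open>\<beta>\<close>, accumulated over time \<open>h\<close>. It is the factor of
  \<open>v\<close> in the displacement by a column move.\<close>

definition gain :: "real \<Rightarrow> real \<Rightarrow> real \<Rightarrow> real" where
  "gain h \<beta> a = integral {0..h} (\<lambda>s. max (a - s * \<beta>) 0)"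

lemma gain_nonpos:
  assumes "\<beta> \<ge> 0" "a \<le> 0"
  shows "gain h \<beta> a = 0"
proof -
  have "integral {0..h} (\<lambda>s. max (a - s * \<beta>) 0) = integral {0..h} (\<lambda>s. 0)"
    by (rule integral_cong) (use assms in \<open>auto intro!: max_absorb2 order_trans[of a 0]\<close>)
  then show ?thesis by (simp add: gain_def)
qed

text \<open>The integrand is continuous, nonnegative and positive at time 0. Positivity allows the
  required displacement to be divided by the gain.\<close>

lemma gain_pos:
  assumes "h > 0" "a > 0"
  shows "gain h \<beta> a > 0"
proof -
  have cont: "continuous_on {0..h} (\<lambda>s. max (a - s * \<beta>) 0)" by (intro continuous_intros)
  have "gain h \<beta> a \<noteq> 0"
    unfolding gain_def integral_eq_0_iff[OF cont assms(1) max.cobounded2]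
    using assms by (auto intro!: bexI[of _ 0])
  moreover have "gain h \<beta> a \<ge> 0"
    unfolding gain_def by (intro integral_nonneg integrable_continuous_real cont) simp
  ultimately show ?thesis by simp
qed

lemma two_layer_column:
  assumes "v $ k = 0"
  shows "two_layer (column_matrix k v, c)"
  using assms by (auto simp: two_layer_def column_matrix_def)

lemma layer_flow_column:
  "layer_flow (column_matrix k v, axis k (- \<beta>)) h x = x - axis k (h * \<beta>) + gain h \<beta> (x $ k) *\<^sub>R v"
proof -
  have int: "(\<lambda>s. pos_part (x + s *\<^sub>R axis k (- \<beta>))) integrable_on {0..h}"
    by (intro integrable_continuous_real continuous_on_pos_part_line)
  have "integral {0..h} (\<lambda>s. pos_part (x + s *\<^sub>R axis k (- \<beta>))) $ k = gain h \<beta> (x $ k)"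
    unfolding gain_def integral_component_eq_cart[OF int, symmetric] by (simp add: pos_part_def)
  then show ?thesis
    by (simp add: layer_flow_def vec_eq_iff column_matrix_def matrix_vector_mult_def axis_def
        if_distrib[of "\<lambda>u. u * _"] mult.commute cong: if_cong)
qed

subsection \<open>Interpolation\<close>

text \<open>Each piece moves the \<open>k\<close>-th coordinate down until the lowest remaining point reaches \<open>0\<close>; that
  point is brought to its target on the way and is not deformed by any later piece.\<close>

lemma steer_other_coordinates:
  fixes z u :: "'i \<Rightarrow> real ^ 'd"
  assumes "finite I" and "h > 0" and "inj_on (\<lambda>i. z i $ k) I" and "\<And>i. i \<in> I \<Longrightarrow> z i $ k > 0"
  shows "\<exists>ps s. length ps = card I \<and> (\<forall>p\<in>set ps. two_layer p) \<and>
    (\<forall>x. fold (\<lambda>p. layer_flow p h) ps x $ k = x $ k - s) \<and>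
    (\<forall>x. x $ k \<le> 0 \<longrightarrow> fold (\<lambda>p. layer_flow p h) ps x = x - axis k s) \<and>
    (\<forall>i\<in>I. \<forall>j. j \<noteq> k \<longrightarrow> fold (\<lambda>p. layer_flow p h) ps (z i) $ j = u i $ j)"
  using assms
\<comment> \<open>\<open>z\<close> is generalised because the first piece also moves the points that
  are treated later.\<close>
proof (induction "card I" arbitrary: I z)
  case 0
  then show ?case by (intro exI[of _ "[]"] exI[of _ 0]) (auto simp: axis_def vec_eq_iff)
next
  case (Suc n)
  then have "I \<noteq> {}" by auto
  define m where "m = arg_min_on (\<lambda>i. z i $ k) I"
  have m: "m \<in> I" "\<And>i. i \<in> I \<Longrightarrow> z m $ k \<le> z i $ k"
    using arg_min_if_finite[OF Suc.prems(1) \<open>I \<noteq> {}\<close>] arg_min_least[OF Suc.prems(1) \<open>I \<noteq> {}\<close>]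
    by (auto simp: m_def)
  define a where "a = z m $ k"
  \<comment> \<open>The speed at which the lowest point \<open>m\<close> reaches level 0 exactly at
    time \<open>h\<close>.\<close>
  define \<beta> where "\<beta> = a / h"
  have "a > 0" using Suc.prems(4) m by (simp add: a_def)
  then have "\<beta> \<ge> 0" "h * \<beta> = a" using \<open>h > 0\<close> by (simp_all add: \<beta>_def)
  define g where "g = gain h \<beta> a"
  have "g > 0" using gain_pos \<open>h > 0\<close> \<open>a > 0\<close> by (simp add: g_def)
  \<comment> \<open>The gain \<open>g\<close> of point \<open>m\<close> turns \<open>v\<close> into
    its missing displacement; the zero in position \<open>k\<close> makes the piece
    two-layer.\<close>
  define v where "v = (\<chi> j. if j = k then 0 else (u m $ j - z m $ j) / g)"
  define p where "p = (column_matrix k v, axis k (- \<beta>))"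
  have p: "two_layer p" by (simp add: p_def v_def two_layer_column)
  have flow: "layer_flow p h x = x - axis k a + gain h \<beta> (x $ k) *\<^sub>R v" for x
    using layer_flow_column[of k v \<beta> h x] \<open>h * \<beta> = a\<close> by (simp add: p_def)
  have flow_k: "layer_flow p h x $ k = x $ k - a" for x by (simp add: flow v_def)
  have flow_nonpos: "layer_flow p h x = x - axis k a" if "x $ k \<le> 0" for x
    using that \<open>\<beta> \<ge> 0\<close> by (simp add: flow gain_nonpos)
  have flow_m: "layer_flow p h (z m) $ j = u m $ j" if "j \<noteq> k" for j
    using that \<open>g > 0\<close> by (simp add: flow v_def flip: a_def g_def) (simp add: axis_def)
  have "n = card (I - {m})" using Suc.hyps(2) m Suc.prems(1) by simp
  moreover have "inj_on (\<lambda>i. layer_flow p h (z i) $ k) (I - {m})"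
    using Suc.prems(3) by (auto simp: flow_k inj_on_def)
  \<comment> \<open>By injectivity the other points start strictly above \<open>m\<close>, so they
    are still above 0 when \<open>m\<close> arrives there.\<close>
  moreover have "layer_flow p h (z i) $ k > 0" if "i \<in> I - {m}" for i
  proof -
    have "z i $ k \<noteq> z m $ k" using that m(1) Suc.prems(3) by (auto simp: inj_on_def)
    then show ?thesis using that m(2)[of i] by (simp add: flow_k a_def)
  qed
  ultimately obtain ps s where ps: "length ps = card (I - {m})" "\<forall>p\<in>set ps. two_layer p"
    and k: "\<And>x. fold (\<lambda>p. layer_flow p h) ps x $ k = x $ k - s"
    and np: "\<And>x. x $ k \<le> 0 \<Longrightarrow> fold (\<lambda>p. layer_flow p h) ps x = x - axis k s"
    and tgt: "\<And>i j. i \<in> I - {m} \<Longrightarrow> j \<noteq> k \<Longrightarrow>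
      fold (\<lambda>p. layer_flow p h) ps (layer_flow p h (z i)) $ j = u i $ j"
    using Suc.hyps(1)[of "I - {m}" "\<lambda>i. layer_flow p h (z i)"] Suc.prems(1) \<open>h > 0\<close> by auto
  show ?case
  proof (intro exI[of _ "p # ps"] exI[of _ "a + s"] conjI ballI allI impI)
    show "length (p # ps) = card I" using ps(1) Suc.hyps(2) \<open>n = card (I - {m})\<close> by simp
    show "two_layer q" if "q \<in> set (p # ps)" for q using that p ps(2) by auto
    show "fold (\<lambda>p. layer_flow p h) (p # ps) x $ k = x $ k - (a + s)" for x
      by (simp add: k flow_k)
    show "fold (\<lambda>p. layer_flow p h) (p # ps) x = x - axis k (a + s)" if "x $ k \<le> 0" for x
      using that \<open>a > 0\<close> np[of "layer_flow p h x"]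
      by (simp add: flow_k flow_nonpos) (simp add: vec_eq_iff axis_def)
    show "fold (\<lambda>p. layer_flow p h) (p # ps) (z i) $ j = u i $ j" if "i \<in> I" "j \<noteq> k" for i j
    proof (cases "i = m")
      \<comment> \<open>Point \<open>m\<close> now has \<open>k\<close>-th coordinate 0, so by
        \<open>np\<close> the later pieces only translate it along axis \<open>k\<close>.\<close>
      case True
      then show ?thesis
        using np[of "layer_flow p h (z m)"] flow_m[OF that(2)] that(2)
        by (simp add: flow_k a_def) (simp add: axis_def)
    next
      case False
      then show ?thesis using tgt that by simp
    qed
  qed
qed

section \<open>Separation of the points in one coordinate\<close>

text \<open>Each pair of points rules out only a hyperplane of vectors \<open>v\<close>; finitely
  many hyperplanes are negligible, whereas the open positive orthant is not.\<close>

lemma exists_positive_separating_vector: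
  fixes x :: "'i \<Rightarrow> real ^ 'd"
  assumes "finite I" "inj_on x I"
  shows "\<exists>v. (\<forall>j. 0 < v $ j) \<and> inj_on (\<lambda>i. v \<bullet> x i) I"
proof -
  let ?P = "{(i, j). i \<in> I \<and> j \<in> I \<and> i \<noteq> j}"
  let ?N = "\<Union>(i, j)\<in>?P. {v. (x i - x j) \<bullet> v = 0}"
  have "finite ?P" by (rule finite_subset[of _ "I \<times> I"]) (use assms in auto)
  then have "negligible ?N"
    using assms(2) by (intro negligible_Union) (auto intro!: negligible_hyperplane simp: inj_on_def)
  moreover have "open {v :: real ^ 'd. \<forall>j. 0 < v $ j}"
    by (simp add: Collect_all_eq) (intro open_INT ballI open_Collect_less continuous_intros; simp)
  moreover have "(\<chi> j. 1) \<in> {v :: real ^ 'd. \<forall>j. 0 < v $ j}" by simp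
  ultimately have "\<not> {v :: real ^ 'd. \<forall>j. 0 < v $ j} \<subseteq> ?N"
    using open_not_negligible negligible_subset by blast
  then obtain v where v: "\<forall>j. 0 < v $ j" "v \<notin> ?N" by blast
  from v(2) have "inj_on (\<lambda>i. v \<bullet> x i) I"
    by (auto simp: inj_on_def inner_diff_right inner_commute[of _ v])
  then show ?thesis using v(1) by blast
qed

text \<open>In the positive orthant \<open>pos_part\<close> is the identity, so a shear acts
  linearly and can be undone. The forward list \<open>ps\<close> serves the initial points, the
  backward list \<open>qs\<close> the targets.\<close>

lemma normalise_points:
  fixes x :: "'i \<Rightarrow> real ^ 'd"
  assumes "finite I" "inj_on x I" "h > 0"
  shows "\<exists>ps qs z. length ps = 2 \<and> length qs = 2 \<and> (\<forall>p\<in>set ps \<union> set qs. two_layer p) \<and>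
    (\<forall>i\<in>I. fold (\<lambda>p. layer_flow p h) ps (x i) = z i \<and>
      fold (\<lambda>p. layer_flow p h) qs (z i) = x i \<and> (\<forall>j. z i $ j > 0)) \<and>
    inj_on (\<lambda>i. z i $ k) I"
proof -
  obtain v where v: "\<And>j. 0 < v $ j" "inj_on (\<lambda>i. v \<bullet> x i) I"
    using exists_positive_separating_vector[OF assms(1,2)] by blast
  define c :: "real ^ 'd" where "c = (\<chi> j. 1 + (\<Sum>i\<in>I. \<bar>x i $ j\<bar>))"
  have pos: "(x i + c) $ j > 0" if "i \<in> I" for i j
    using member_le_sum[OF that, of "\<lambda>i. \<bar>x i $ j\<bar>"] assms(1) by (simp add: c_def)
  \<comment> \<open>Chosen so that \<open>w + axis k 1\<close> is \<open>v\<close> divided by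
    \<open>v $ k\<close>: after the shear, coordinate \<open>k\<close> is a positive multiple of the
    separating functional.\<close>
  define w where "w = (\<chi> j. if j = k then 0 else v $ j / v $ k)"
  have w: "w $ k = 0" "\<And>j. w $ j \<ge> 0" using v(1) by (auto simp: w_def less_imp_le)
  define z where "z i = x i + c + axis k (w \<bullet> (x i + c))" for i
  have w_pos: "w \<bullet> (x i + c) \<ge> 0" if "i \<in> I" for i
    unfolding inner_vec_def by (intro sum_nonneg) (use w pos[OF that] in \<open>simp add: less_imp_le\<close>)
  have z_pos: "z i $ j > 0" if "i \<in> I" for i j
    using pos[OF that, of j] w_pos[OF that] by (auto simp: z_def axis_def)
  have pp: "pos_part y = y" if "\<And>j. y $ j > 0" for y :: "real ^ 'd"
    using that by (simp add: pos_part_def vec_eq_iff less_imp_le max_absorb1)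
  have w_axis: "w \<bullet> axis k r = 0" for r by (simp add: inner_axis w)
  have "w = v /\<^sub>R (v $ k) - axis k 1"
    using v(1)[of k] by (simp add: w_def vec_eq_iff axis_def field_simps)
  then have z_k: "z i $ k = (v \<bullet> (x i + c)) / v $ k" for i
    by (simp add: z_def inner_diff_left inner_axis' divide_inverse mult.commute)
  have inj: "inj_on (\<lambda>i. z i $ k) I"
    using v(2) v(1)[of k] by (simp add: z_k inj_on_def inner_add_right)
  let ?t = "\<lambda>c. (0, c /\<^sub>R h)" and ?s = "\<lambda>w. (row_matrix k (w /\<^sub>R h), 0)"
  have fw: "fold (\<lambda>p. layer_flow p h) [?t c, ?s w] (x i) = z i" if "i \<in> I" for i
    using \<open>h > 0\<close> pp[OF pos[OF that]]
    by (simp add: layer_flow_translation layer_flow_shear z_def)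
  \<comment> \<open>The shear moves points along axis \<open>k\<close> only, which is orthogonal to
    \<open>w\<close>; hence the inverse shear subtracts exactly what was added.\<close>
  have bw: "fold (\<lambda>p. layer_flow p h) [?s (- w), ?t (- c)] (z i) = x i" if "i \<in> I" for i
  proof -
    have "z i + axis k (- w \<bullet> z i) = x i + c"
      unfolding z_def by (simp add: inner_add_right w_axis) (simp add: vec_eq_iff axis_def)
    then show ?thesis
      using \<open>h > 0\<close> pp[OF z_pos[OF that]] layer_flow_translation[of h "- c"]
        layer_flow_shear[of h k "- w"] by simp
  qed
  show ?thesis
  proof (intro exI conjI)
    show "length [?t c, ?s w] = 2" "length [?s (- w), ?t (- c)] = 2" by auto
    show "\<forall>p\<in>set [?t c, ?s w] \<union> set [?s (- w), ?t (- c)]. two_layer p"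
      using w(1) by (auto intro!: two_layer_translation two_layer_shear)
  qed (use fw bw z_pos inj in auto)
qed

section \<open>Assembly of the control\<close>

theorem proposition1p9:
  fixes T :: real and n :: nat and x y :: "nat \<Rightarrow> real ^ 'd"
  assumes "CARD('d) \<ge> 2"
    and "n \<ge> 1"
    and "T > 0"
    and "\<And>i j. i \<in> {1..n} \<Longrightarrow> j \<in> {1..n} \<Longrightarrow> i \<noteq> j \<Longrightarrow> x i \<noteq> x j \<and> y i \<noteq> y j"
  shows "\<exists>(\<theta> :: real \<Rightarrow> (real ^ 'd ^ 'd) \<times> (real ^ 'd)) \<Phi>.
           piecewise_constant_on 0 T \<theta> \<and>
           finite (switches 0 T \<theta>) \<and> card (switches 0 T \<theta>) \<le> 4 * n + 2 \<and>
           is_flow_map T \<theta> \<Phi> \<and>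
           (\<forall>i\<in>{1..n}. \<Phi> T (x i) = y i)"
proof -
  \<comment> \<open>All \<open>2 * n + 5\<close> pieces get the same duration: two to normalise,
    \<open>n\<close> for each pass, one translation, and two to return to the targets.\<close>
  define h where "h = T / real (2 * n + 5)"
  have "h > 0" using assms(3) by (simp add: h_def)
  let ?run = "fold (\<lambda>p. layer_flow p h)"
  obtain k l :: 'd where "k \<noteq> l"
    using assms(1) by (metis One_nat_def card_le_Suc0_iff_eq finite_class.finite_UNIV not_less_eq_eq numeral_2_eq_2)
  have "inj_on x {1..n}" "inj_on y {1..n}" using assms(4) by (meson inj_onI)+
  then obtain ps1 z where
    ps1: "length ps1 = 2" "\<forall>p\<in>set ps1. two_layer p" "\<And>i. i \<in> {1..n} \<Longrightarrow> ?run ps1 (x i) = z i"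
    and z: "\<And>i j. i \<in> {1..n} \<Longrightarrow> z i $ j > 0" "inj_on (\<lambda>i. z i $ k) {1..n}"
    using normalise_points[of "{1..n}" x h k] \<open>h > 0\<close> by blast
  \<comment> \<open>Only the backward half is kept for the targets: it carries the intermediate
    targets \<open>z'\<close> to \<open>y\<close>.\<close>
  obtain ps5 z' where
    ps5: "length ps5 = 2" "\<forall>p\<in>set ps5. two_layer p" "\<And>i. i \<in> {1..n} \<Longrightarrow> ?run ps5 (z' i) = y i"
    and z': "\<And>i j. i \<in> {1..n} \<Longrightarrow> z' i $ j > 0" "inj_on (\<lambda>i. z' i $ l) {1..n}"
    using normalise_points[of "{1..n}" y h l] \<open>h > 0\<close> \<open>inj_on y {1..n}\<close> by blast
  obtain ps2 where ps2: "length ps2 = n" "\<forall>p\<in>set ps2. two_layer p"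
    "\<And>i j. i \<in> {1..n} \<Longrightarrow> j \<noteq> k \<Longrightarrow> ?run ps2 (z i) $ j = z' i $ j"
    using steer_other_coordinates[OF finite_atLeastAtMost \<open>h > 0\<close> z(2) z(1), of z'] by auto
  define q where "q i = ?run ps2 (z i)" for i
  have q: "q i $ l = z' i $ l" if "i \<in> {1..n}" for i
    using ps2(3)[OF that] \<open>k \<noteq> l\<close> by (simp add: q_def)
  \<comment> \<open>The first pass has already matched coordinate \<open>l\<close> with
    \<open>z'\<close>, so the points inherit separation and positivity there, as the second pass
    requires.\<close>
  have "inj_on (\<lambda>i. q i $ l) {1..n} \<longleftrightarrow> inj_on (\<lambda>i. z' i $ l) {1..n}"
    by (rule inj_on_cong) (rule q)
  with z'(2) have "inj_on (\<lambda>i. q i $ l) {1..n}" by simp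
  moreover have "q i $ l > 0" if "i \<in> {1..n}" for i using z'(1) q that by simp
  ultimately obtain ps3 s where ps3: "length ps3 = n" "\<forall>p\<in>set ps3. two_layer p"
    "\<And>u. ?run ps3 u $ l = u $ l - s"
    "\<And>i j. i \<in> {1..n} \<Longrightarrow> j \<noteq> l \<Longrightarrow> ?run ps3 (q i) $ j = z' i $ j"
    using steer_other_coordinates[OF finite_atLeastAtMost \<open>h > 0\<close>, of q l 1 n z'] by auto
  \<comment> \<open>The second pass lowered coordinate \<open>l\<close> of all points by the same
    amount \<open>s\<close>; this translation restores it.\<close>
  define p4 :: "(real ^ 'd ^ 'd) \<times> (real ^ 'd)" where "p4 = (0, axis l s /\<^sub>R h)"
  have p4: "layer_flow p4 h (?run ps3 (q i)) = z' i" if "i \<in> {1..n}" for i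
    using \<open>h > 0\<close> ps3(3)[of "q i"] ps3(4)[OF that] q[OF that]
    by (auto simp: p4_def layer_flow_translation vec_eq_iff axis_def)
  define ps where "ps = ps1 @ ps2 @ ps3 @ p4 # ps5"
  have len: "length ps = 2 * n + 5" using ps1 ps2 ps3 ps5 by (simp add: ps_def)
  have T: "T = real (length ps) * h" by (simp add: len h_def)
  interpret control_sequence ps h
  proof
    show "ps \<noteq> []" by (simp add: ps_def)
    show "two_layer p" if "p \<in> set ps" for p
      using that ps1(2) ps2(2) ps3(2) ps5(2) two_layer_translation by (auto simp: ps_def p4_def)
  qed (rule \<open>h > 0\<close>)
  have "flow T (x i) = y i" if "i \<in> {1..n}" for i
    using that ps1(3) p4 ps5(3) by (simp add: T flow_end) (simp add: ps_def flip: q_def)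
  \<comment> \<open>The count is \<open>2 * n + 4\<close>, which is at most \<open>4 * n + 2\<close>
    because \<open>n\<close> is at least 1.\<close>
  moreover have "card (switches 0 T control) \<le> 4 * n + 2"
    using card_switches assms(2) by (simp add: T len)
  ultimately show ?thesis
    using piecewise_constant_control finite_switches flow_is_flow_map unfolding T by blast
qed

end
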